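(* Let $t\ge 2$ be an integer and let $G$ be a finite graph that is topologically $t$-chromatic, i.e. $\mathrm{coind}(B_0(G))\ge t-1$. Then $$\psi(G)\ge\left\lceil \frac t2\right\rceil+1.$$
   Context: All graphs are simple. For a vertex $v$ of a graph $G$, $N(v)$ denotes the set of neighbours of $v$. The local chromatic number is $\psi(G)=\min_c\max_{v\in V(G)}|\{c(u):u\in N(v)\}|+1$, the minimum taken over all proper colorings $c$ of $G$ (with any number of colors). Box complex: $B_0(G)$ is the simplicial complex on vertex set $V(G)\times\{1,2\}$; for $S,T\subseteq V(G)$ write $S\uplus T=S\times\{1\}\cup T\times\{2\}$; then $S\uplus T$ is a simplex of $B_0(G)$ iff $S\cap T=\emptyset$ and every vertex of $S$ is adjacent in $G$ to every vertex of $T$ (so $S\uplus\emptyset$ and $\emptyset\uplus T$ are always simplices). The simplicial map $S\uplus T\mapsto T\uplus S$ induces a free continuous involution $\nu$ on the geometric realization $\|B_0(G)\|$. For a topological space $X$ with a continuous involution $\nu$, $\mathrm{coind}(X)=\max\{d\ge 0:\exists$ continuous $f:S^d\to X$ with $f(-x)=\nu(f(x))$ for all $x\}$ (and $\infty$ if such maps exist for all $d$); here $S^d\subset\mathbb R^{d+1}$ is the unit sphere. We write $\mathrm{coind}(B_0(G))$ for $\mathrm{coind}(\|B_0(G)\|)$. A finite graph is called topologically $t$-chromatic if $\mathrm{coind}(B_0(G))\ge t-1$. *)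

theory Defs
  imports "HOL-Analysis.Analysis" "Graph_Theory.Pair_Digraph"
begin

text \<open>
  A finite simple graph is a \<^const>\<open>pair_graph\<close>: a finite vertex set \<^term>\<open>pverts G\<close> together with a
  symmetric irreflexive relation \<^term>\<open>parcs G\<close> on it, each edge being present in both directions.
\<close>

definition neighbours :: "'a pair_pre_digraph \<Rightarrow> 'a \<Rightarrow> 'a set"
  where "neighbours G v = {u. (v, u) \<in> parcs G}"

definition proper_coloring :: "'a pair_pre_digraph \<Rightarrow> ('a \<Rightarrow> 'c) \<Rightarrow> bool"
  where "proper_coloring G c \<longleftrightarrow> (\<forall>(u, v) \<in> parcs G. c u \<noteq> c v)"

text \<open>
  Colors are natural numbers, which puts no bound on the number of colors available for a finite
  graph. The infimum is a minimum, since a finite graph has a proper coloring. \<^const>\<open>Max\<close> is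
  meaningful for finite graphs with at least one vertex only.
\<close>

definition local_chromatic_number :: "'a pair_pre_digraph \<Rightarrow> nat"
  where "local_chromatic_number G =
    (INF c \<in> {c :: 'a \<Rightarrow> nat. proper_coloring G c}.
       (MAX v \<in> pverts G. card (c ` neighbours G v))) + 1"

definition box_join :: "'a set \<Rightarrow> 'a set \<Rightarrow> ('a \<times> nat) set"
  where "box_join S T = S \<times> {1} \<union> T \<times> {2}"

definition box_complex :: "'a pair_pre_digraph \<Rightarrow> ('a \<times> nat) set set"
  where "box_complex G = {box_join S T | S T.
    S \<subseteq> pverts G \<and> T \<subseteq> pverts G \<and> S \<inter> T = {} \<and> (\<forall>s\<in>S. \<forall>t\<in>T. (s, t) \<in> parcs G)}"

text \<open>
  The realization of a finite abstract simplicial complex, in barycentric coordinates. The empty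
  simplex contributes no point. For infinite complexes the subspace topology used here would
  differ from the usual weak topology.
\<close>

definition geometric_realization :: "'v set set \<Rightarrow> ('v \<Rightarrow> real) topology"
  where "geometric_realization K = subtopology (powertop_real UNIV)
    {x. (\<forall>v. 0 \<le> x v) \<and> {v. x v \<noteq> 0} \<in> K \<and> (\<Sum>v | x v \<noteq> 0. x v) = 1}"

definition box_swap :: "'a \<times> nat \<Rightarrow> 'a \<times> nat"
  where "box_swap = (\<lambda>(v, i). (v, 3 - i))"

text \<open>
  The affine extension of \<^const>\<open>box_swap\<close> to the realization; since \<^const>\<open>box_swap\<close> is its own
  inverse on the vertices of the complex, it acts on barycentric coordinates by precomposition.
\<close>

definition box_involution :: "('a \<times> nat \<Rightarrow> real) \<Rightarrow> ('a \<times> nat \<Rightarrow> real)"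
  where "box_involution x = x \<circ> box_swap"

text \<open>
  The supremum is the maximum when the set is finite and nonempty, and \<open>\<infinity>\<close> when it is
  unbounded. It is \<open>-\<infinity>\<close> if there is no equivariant map at all, i.e. for the empty space.
\<close>

definition coind :: "'b topology \<Rightarrow> ('b \<Rightarrow> 'b) \<Rightarrow> ereal"
  where "coind X \<nu> = Sup {ereal (real d) | d :: nat.
    \<exists>f. continuous_map (nsphere d) X f \<and>
        (\<forall>x \<in> topspace (nsphere d). f (\<lambda>i. - x i) = \<nu> (f x))}"

definition topologically_chromatic :: "int \<Rightarrow> 'a pair_pre_digraph \<Rightarrow> bool"
  where "topologically_chromatic t G \<longleftrightarrow>
    coind (geometric_realization (box_complex G)) box_involution \<ge> ereal (real_of_int (t - 1))"

lemma box_swap_image: "box_swap ` box_join S T = box_join T S"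
  by (force simp: box_swap_def box_join_def image_iff)

lemma box_swap_in_box_complex:
  assumes "pair_graph G" and "A \<in> box_complex G"
  shows "box_swap ` A \<in> box_complex G"
proof -
  interpret pair_graph G by fact
  from assms(2) show ?thesis
    unfolding box_complex_def
    by (clarsimp simp: box_swap_image) (blast intro: arcs_symmetric)
qed

lemma box_complex_free: "A \<in> box_complex G \<Longrightarrow> (v, i) \<in> A \<Longrightarrow> box_swap (v, i) \<notin> A"
  by (auto simp: box_complex_def box_join_def box_swap_def)

lemma box_involution:
  assumes "pair_graph G"
  defines "X \<equiv> geometric_realization (box_complex G)"
  shows "continuous_map X X box_involution"
    and "x \<in> topspace X \<Longrightarrow> box_involution (box_involution x) = x"
    and "x \<in> topspace X \<Longrightarrow> box_involution x \<noteq> x"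
proof -
  have supp: "{w. box_involution x w \<noteq> 0} = box_swap ` {w. x w \<noteq> 0} \<and>
      inj_on box_swap {w. x w \<noteq> 0} \<and> box_involution (box_involution x) = x"
    if A: "{w. x w \<noteq> 0} \<in> box_complex G" for x
  proof -
    have x0: "i = 1 \<or> i = 2" if "x (v, i) \<noteq> 0" for v i
    proof -
      have "(v, i) \<in> {w. x w \<noteq> 0}" using that by simp
      with A show ?thesis
        by (auto simp: box_complex_def box_join_def)
    qed
    have sw: "x (box_swap (box_swap w)) = x w" for w
    proof (cases w)
      case (Pair v i)
      show ?thesis
      proof (cases "i \<le> 3")
        case False
        then have "x (v,i) = 0" "x (v,3) = 0" using x0[of v i] x0[of v 3] by auto
        then show ?thesis using False Pair by (simp add: box_swap_def)
      qed (simp add: Pair box_swap_def)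
    qed
    have ss: "box_swap (box_swap w) = w" if "x w \<noteq> 0" for w
      using x0[of "fst w" "snd w"] that by (cases w) (auto simp: box_swap_def)
    have ss': "box_swap (box_swap w) = w" if "x (box_swap w) \<noteq> 0" for w
      using x0[of "fst w" "3 - snd w"] that by (cases w) (auto simp: box_swap_def)
    have "{w. x (box_swap w) \<noteq> 0} = box_swap ` {w. x w \<noteq> 0}" (is "?L = ?M")
    proof
      show "?L \<subseteq> ?M"
      proof
        fix w assume "w \<in> ?L"
        then have "box_swap w \<in> {w. x w \<noteq> 0}" "w = box_swap (box_swap w)" using ss'[of w] by simp_all
        then show "w \<in> ?M" by blast
      qed
      show "?M \<subseteq> ?L" using sw by auto
    qed
    moreover have "inj_on box_swap {w. x w \<noteq> 0}" by (rule inj_on_inverseI[of _ box_swap]) (use ss in simp)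
    ultimately show ?thesis using sw by (simp add: box_involution_def fun_eq_iff)
  qed
  let ?R = "topspace X"
  have R: "?R = {x. (\<forall>v. 0 \<le> x v) \<and> {v. x v \<noteq> 0} \<in> box_complex G \<and> (\<Sum>v | x v \<noteq> 0. x v) = 1}"
    by (simp add: X_def geometric_realization_def)
  show "box_involution (box_involution x) = x" if "x \<in> ?R" using supp that R by auto
  have into: "box_involution x \<in> ?R" if "x \<in> ?R" for x
  proof -
    have A: "{v. x v \<noteq> 0} \<in> box_complex G" using that R by auto
    note s = supp[OF A]
    have "(\<Sum>v | box_involution x v \<noteq> 0. box_involution x v) = (\<Sum>v | x v \<noteq> 0. box_involution x (box_swap v))"
      using s by (simp add: sum.reindex)
    also have "\<dots> = (\<Sum>v | x v \<noteq> 0. x v)"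
      by (rule sum.cong) (use s in \<open>auto simp: box_involution_def fun_eq_iff\<close>)
    finally show ?thesis
      using that s box_swap_in_box_complex[OF assms(1) A] unfolding R
      by (simp add: box_involution_def[of x] del: split_paired_All)
  qed
  have cont: "continuous_map (powertop_real UNIV) (powertop_real UNIV) (box_involution :: ('b \<times> nat \<Rightarrow> real) \<Rightarrow> _)"
    unfolding continuous_map_componentwise_UNIV box_involution_def o_def
    by (auto intro: continuous_map_product_projection)
  show "continuous_map X X box_involution"
    unfolding X_def geometric_realization_def
    apply (rule continuous_map_into_subtopology)
     apply (rule continuous_map_from_subtopology[OF cont])
    using into R by (auto simp: X_def geometric_realization_def)
  show "box_involution x \<noteq> x" if "x \<in> ?R"
  proof
    assume e: "box_involution x = x"
    have A: "{v. x v \<noteq> 0} \<in> box_complex G" "(\<Sum>v | x v \<noteq> 0. x v) = 1" using that R by auto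
    have "{v. x v \<noteq> 0} \<noteq> {}" using A(2) by force
    then obtain v i where v: "x (v,i) \<noteq> 0" by auto
    then have "x (box_swap (v,i)) \<noteq> 0" using fun_cong[OF e, of "(v,i)"] by (simp add: box_involution_def)
    then show False using box_complex_free[OF A(1), of v i] v by simp
  qed
qed

lemma proper_coloring_exists:
  fixes G :: "'a pair_pre_digraph"
  assumes "pair_graph G" shows "\<exists>c :: 'a \<Rightarrow> nat. proper_coloring G c"
proof -
  interpret pair_graph G by fact
  obtain c :: "'a \<Rightarrow> nat" where "inj_on c (pverts G)"
    using finite_imp_inj_to_nat_seg[OF pair_finite_verts] by blast
  moreover have "fst e \<noteq> snd e" if "e \<in> parcs G" for e using pair_no_loops that by blast
  ultimately have "proper_coloring G c"
    unfolding proper_coloring_def inj_on_def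
    by clarsimp (metis arc_fst_in_verts arc_snd_in_verts fst_conv snd_conv)
  then show ?thesis by blast
qed

end

theory Submission
  imports Defs "HOL-Homology.Invariance_of_Domain"
begin

text \<open>
  Fix a proper coloring \<open>c\<close> by natural numbers and an equivariant map from the sphere of dimension
  \<open>d \<ge> t - 1\<close> to the box complex. A point \<open>y\<close> of the box complex defines the signed weight
  \<open>w v = y (v, 1) - y (v, 2)\<close>, and its moments \<open>\<Sum>v. w v * c v ^ k\<close> for \<open>k < d\<close> are \<open>d\<close> odd functions on
  the sphere, so by the Borsuk-Ulam theorem they vanish simultaneously somewhere. The weight found there
  annihilates all polynomials of degree less than \<open>d\<close> in the colors. Testing it against suitable
  polynomials shows that both sides of the simplex supporting \<open>y\<close> are nonempty and that the side
  containing the smallest color has at least \<open>(d + 1) / 2\<close> colors, all of which are seen by any vertex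
  of the other side. This replaces Fan's theorem on alternating colorings.

  The Borsuk-Ulam theorem follows from the fact that odd self-maps of spheres have odd degree.
\<close>

section \<open>Lipschitz maps on spheres\<close>

text \<open>
  Pigeonhole: a grid of mesh \<open>1/N\<close> in the cube of dimension \<open>m + 1\<close> has at least \<open>N\<^bsup>m+1\<^esup>\<close> points,
  whereas \<open>O(N\<^sup>m)\<close> cells so small that \<open>Y\<close> cannot send two grid points to the same one cover its range.
\<close>

lemma no_expanding_map:
  fixes Y :: "(nat \<Rightarrow> real) \<Rightarrow> nat \<Rightarrow> real"
  assumes K: "0 \<le> K"
    and bounded: "\<And>z j. \<lbrakk>\<forall>i\<le>m. 0 \<le> z i \<and> z i \<le> 1; j < m\<rbrakk> \<Longrightarrow> \<bar>Y z j\<bar> \<le> R"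
    and expanding: "\<And>z z' i. \<lbrakk>\<forall>i\<le>m. 0 \<le> z i \<and> z i \<le> 1; \<forall>i\<le>m. 0 \<le> z' i \<and> z' i \<le> 1; i \<le> m\<rbrakk>
                \<Longrightarrow> \<bar>z i - z' i\<bar> \<le> K * (\<Sum>j<m. \<bar>Y z j - Y z' j\<bar>)"
  shows False
proof -
  obtain R0 :: nat where R0: "R \<le> real R0"
    using real_arch_simple by blast
  obtain K0 :: nat where K0: "K * real m < real K0"
    using reals_Archimedean2 by blast
  define R' where "R' = Suc R0"
  have R': "R \<le> real R'" "R' \<ge> 1" using R0 by (auto simp: R'_def)
  \<comment> \<open>\<open>C\<close> and \<open>N\<close> are tuned for the final count: there are
    at most \<open>(C * N) ^ m\<close> cells, and \<open>N > C ^ m\<close> makes this less than the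
    \<open>N * N ^ m\<close> grid points. Cells have side \<open>1 / M\<close>, small enough that
    \<open>K * m / M < 1 / N\<close>.\<close>
  define C where "C = 3 * R' * K0"
  define N where "N = C ^ m + 1"
  define M where "M = K0 * N"
  have "K0 > 0" using K0 K by (metis mult_nonneg_nonneg not_gr_zero of_nat_0 of_nat_0_le_iff not_less)
  then have "M > 0" "N > 0" by (auto simp: M_def N_def)
  define z where "z a = (\<lambda>i. real (a i) / real N)" for a :: "nat \<Rightarrow> nat"
  define cell where "cell a = (\<lambda>j\<in>{..<m}. \<lfloor>Y (z a) j * real M\<rfloor>)" for a
  define grid where "grid = (\<Pi>\<^sub>E i\<in>{..m}. {..<N})"
  define cells where "cells = (\<Pi>\<^sub>E i\<in>{..<m}. {- int (R' * M)..int (R' * M)})"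
  have z: "\<forall>i\<le>m. 0 \<le> z a i \<and> z a i \<le> 1" if "a \<in> grid" for a
    using that by (fastforce simp: grid_def z_def PiE_iff less_imp_le divide_le_eq_1)
  \<comment> \<open>Grid points in one cell have images at most \<open>1 / M\<close> apart in each
    coordinate, so by \<open>expanding\<close> their integer coordinates differ by less than
    1.\<close>
  have "inj_on cell grid"
  proof (rule inj_onI)
    fix a b assume a: "a \<in> grid" and b: "b \<in> grid" and eq: "cell a = cell b"
    have *: "\<bar>Y (z a) j - Y (z b) j\<bar> \<le> 1 / real M" if "j < m" for j
    proof -
      have "\<lfloor>Y (z a) j * real M\<rfloor> = \<lfloor>Y (z b) j * real M\<rfloor>"
        using fun_cong[OF eq, of j] that by (simp add: cell_def)
      then have "\<bar>Y (z a) j * real M - Y (z b) j * real M\<bar> \<le> 1" by linarith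
      then have "\<bar>Y (z a) j - Y (z b) j\<bar> * real M \<le> 1"
        by (simp add: abs_mult flip: left_diff_distrib)
      then show ?thesis using \<open>M > 0\<close> by (simp add: field_simps)
    qed
    have "a i = b i" if "i \<le> m" for i
    proof -
      have "\<bar>z a i - z b i\<bar> \<le> K * (\<Sum>j<m. \<bar>Y (z a) j - Y (z b) j\<bar>)"
        using expanding z a b that by blast
      also have "\<dots> \<le> K * (\<Sum>j<m. 1 / real M)"
        by (intro mult_left_mono sum_mono K) (use * in auto)
      also have "\<dots> = K * real m / real M" by simp
      also have "\<dots> < real K0 / real M"
        using K0 \<open>M > 0\<close> by (simp add: divide_strict_right_mono)
      also have "\<dots> = 1 / real N" using \<open>K0 > 0\<close> by (simp add: M_def)
      finally have "\<bar>real (a i) - real (b i)\<bar> / real N < 1 / real N"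
        by (simp add: z_def flip: diff_divide_distrib)
      then have "\<bar>real (a i) - real (b i)\<bar> < 1" using \<open>N > 0\<close> by (simp add: divide_less_cancel)
      then show ?thesis by linarith
    qed
    then show "a = b" using a b unfolding grid_def by (intro PiE_ext[of a]) auto
  qed
  moreover have "cell ` grid \<subseteq> cells"
  proof (rule image_subsetI)
    fix a assume a: "a \<in> grid"
    have "\<lfloor>Y (z a) j * real M\<rfloor> \<in> {- int (R' * M)..int (R' * M)}" if "j < m" for j
    proof -
      have "\<bar>Y (z a) j * real M\<bar> \<le> real R' * real M"
        using order_trans[OF bounded[OF z[OF a] that] R'(1)] by (simp add: abs_mult mult_right_mono)
      then have "- real (R' * M) \<le> Y (z a) j * real M" "Y (z a) j * real M \<le> real (R' * M)"
        by auto
      then show ?thesis by (auto simp: le_floor_iff floor_le_iff)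
    qed
    then show "cell a \<in> cells" by (auto simp: cell_def cells_def)
  qed
  moreover have "finite cells" by (auto simp: cells_def intro: finite_PiE)
  ultimately have "card grid \<le> card cells" by (rule card_inj_on_le)
  also have "card cells = (2 * (R' * M) + 1) ^ m"
    by (simp add: cells_def card_PiE nat_add_distrib nat_mult_distrib mult_ac)
  also have "\<dots> \<le> (C * N) ^ m"
  proof (rule power_mono)
    have "1 \<le> R' * M" using R'(2) \<open>M > 0\<close> by (simp add: Suc_le_eq)
    then show "2 * (R' * M) + 1 \<le> C * N" by (simp add: C_def M_def algebra_simps)
  qed simp
  also have "\<dots> < N * N ^ m" using \<open>N > 0\<close> by (simp only: power_mult_distrib mult_less_cancel2) (simp add: N_def)
  finally show False by (simp add: grid_def card_PiE)
qed

lemma abs_nsphere_le_1: "x \<in> topspace (nsphere n) \<Longrightarrow> \<bar>x i\<bar> \<le> 1"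
  using topspace_nsphere_1 abs_square_le_1 by blast

lemma topspace_nsphere: "topspace (nsphere n) = {x. (\<Sum>i\<le>n. (x i)\<^sup>2) = 1 \<and> (\<forall>i>n. x i = 0)}"
  by (simp add: nsphere)

lemma uminus_nsphere: "x \<in> topspace (nsphere n) \<Longrightarrow> (\<lambda>i. - x i) \<in> topspace (nsphere n)"
  by (simp add: topspace_nsphere)

text \<open>
  If no direction is missed, every point \<open>z\<close> of a cube lies on the cone over the image of \<open>q\<close>, say
  \<open>z = r q(x)\<close> with \<open>r > 0\<close>, and \<open>z \<mapsto> r x\<close> is an expanding map into a space of lower dimension.
\<close>

lemma lipschitz_misses_direction:
  fixes q :: "(nat \<Rightarrow> real) \<Rightarrow> nat \<Rightarrow> real" and k :: nat
  defines "S \<equiv> topspace (nsphere k)"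
  assumes L: "0 \<le> L"
    and lip: "\<And>x y i. \<lbrakk>x \<in> S; y \<in> S; i \<le> Suc k\<rbrakk> \<Longrightarrow> \<bar>q x i - q y i\<bar> \<le> L * (\<Sum>j\<le>k. \<bar>x j - y j\<bar>)"
    and odd_q: "\<And>x i. \<lbrakk>x \<in> S; i \<le> Suc k\<rbrakk> \<Longrightarrow> q (\<lambda>i. - x i) i = - q x i"
    and upper: "\<And>x i. \<lbrakk>x \<in> S; i \<le> Suc k\<rbrakk> \<Longrightarrow> \<bar>q x i\<bar> \<le> B"
    and lower: "\<And>x. x \<in> S \<Longrightarrow> 1/2 \<le> (\<Sum>i\<le>Suc k. \<bar>q x i\<bar>)"
  obtains p where "p (Suc k) = 1" "\<And>x. x \<in> S \<Longrightarrow> \<exists>i\<le>Suc k. q x i \<noteq> q x (Suc k) * p i"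
proof -
  have False if contra: "\<And>p. p (Suc k) = 1 \<Longrightarrow> \<exists>x\<in>S. \<forall>i\<le>Suc k. q x i = q x (Suc k) * p i"
  proof -
    define cube where "cube z \<longleftrightarrow> (\<forall>i\<le>Suc k. 0 \<le> z i \<and> z i \<le> 1)" for z :: "nat \<Rightarrow> real"
    \<comment> \<open>The cube is shifted by 1 to make all coordinates positive: the direction can
      then be scaled to last coordinate 1, and \<open>r\<close> is nonzero.\<close>
    have "\<exists>r x. 0 < r \<and> r \<le> 4 * (real k + 2) \<and> x \<in> S \<and> (\<forall>i\<le>Suc k. 1 + z i = r * q x i)"
      if z: "cube z" for z
    proof -
      have pos: "1 + z i > 0" if "i \<le> Suc k" for i using z that by (fastforce simp: cube_def)
      define p where "p i = (1 + z i) / (1 + z (Suc k))" for i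
      obtain x where x: "x \<in> S" "\<And>i. i \<le> Suc k \<Longrightarrow> q x i = q x (Suc k) * p i"
        using contra[of p] pos[of "Suc k"] by (auto simp: p_def)
      have "q x (Suc k) \<noteq> 0"
      proof
        assume "q x (Suc k) = 0"
        then have "q x i = 0" if "i \<le> Suc k" for i using x(2)[OF that] by simp
        then have "(\<Sum>i\<le>Suc k. \<bar>q x i\<bar>) = 0" by simp
        then show False using lower[OF x(1)] by linarith
      qed
      define r where "r = (1 + z (Suc k)) / q x (Suc k)"
      have r: "1 + z i = r * q x i" if "i \<le> Suc k" for i
        using x(2)[OF that] pos[of "Suc k"] \<open>q x (Suc k) \<noteq> 0\<close> by (simp add: r_def p_def)
      have "r \<noteq> 0" using r[of 0] pos[of 0] by auto
      have "\<bar>r\<bar> * (1/2) \<le> \<bar>r\<bar> * (\<Sum>i\<le>Suc k. \<bar>q x i\<bar>)"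
        by (intro mult_left_mono lower x) auto
      also have "\<dots> = (\<Sum>i\<le>Suc k. \<bar>1 + z i\<bar>)"
        unfolding sum_distrib_left by (intro sum.cong) (auto simp: r abs_mult)
      also have "\<dots> \<le> (\<Sum>i\<le>Suc k. 2)"
        by (intro sum_mono) (use z in \<open>auto simp: cube_def\<close>)
      finally have "\<bar>r\<bar> \<le> 4 * (real k + 2)" by simp
      then show ?thesis
      proof (cases "r > 0")
        case True
        then show ?thesis using x(1) r \<open>\<bar>r\<bar> \<le> _\<close> by (intro exI[of _ r] exI[of _ x]) auto
      next
        case False
        \<comment> \<open>For negative \<open>r\<close> the antipode of \<open>x\<close> serves,
          because \<open>q\<close> is odd.\<close>
        have "(\<lambda>i. - x i) \<in> S" using x(1) by (simp add: S_def uminus_nsphere)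
        then show ?thesis using x(1) r \<open>\<bar>r\<bar> \<le> _\<close> False \<open>r \<noteq> 0\<close>
          by (intro exI[of _ "-r"] exI[of _ "\<lambda>i. - x i"]) (auto simp: odd_q)
      qed
    qed
    then obtain r x where r: "\<And>z. cube z \<Longrightarrow> 0 < r z" "\<And>z. cube z \<Longrightarrow> r z \<le> 4 * (real k + 2)"
      and x: "\<And>z. cube z \<Longrightarrow> x z \<in> S" and zeq: "\<And>z i. \<lbrakk>cube z; i \<le> Suc k\<rbrakk> \<Longrightarrow> 1 + z i = r z * q (x z) i"
      by metis
    define Y where "Y z j = r z * x z j" for z j
    have x1: "\<bar>x z j\<bar> \<le> 1" if "cube z" for z j
      using x[OF that] abs_nsphere_le_1 by (simp add: S_def)
    have B: "0 \<le> B" using upper[of "x (\<lambda>_. 0)" 0] x[of "\<lambda>_. 0"] by (force simp: cube_def)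
    \<comment> \<open>Since \<open>x z\<close> is a unit vector, the scale \<open>r z\<close> is the
      norm of \<open>Y z\<close>; hence changes of \<open>r\<close> are controlled by changes of
      \<open>Y\<close>.\<close>
    have rY: "r z = L2_set (Y z) {..k}" if "cube z" for z
    proof -
      have "(\<Sum>j\<le>k. (Y z j)\<^sup>2) = (r z)\<^sup>2"
        using x[OF that] by (simp add: Y_def power_mult_distrib S_def topspace_nsphere flip: sum_distrib_left)
      then show ?thesis using r(1)[OF that] by (simp add: L2_set_def)
    qed
    have rdiff: "r z - r z' \<le> (\<Sum>j\<le>k. \<bar>Y z j - Y z' j\<bar>)" if "cube z" "cube z'" for z z'
    proof -
      have "L2_set (\<lambda>j. Y z' j + (Y z j - Y z' j)) {..k}
          \<le> L2_set (Y z') {..k} + L2_set (\<lambda>j. Y z j - Y z' j) {..k}"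
        by (rule L2_set_triangle_ineq)
      moreover have "L2_set (\<lambda>j. Y z j - Y z' j) {..k} \<le> (\<Sum>j\<le>k. \<bar>Y z j - Y z' j\<bar>)"
        by (rule L2_set_le_sum_abs)
      ultimately show ?thesis using rY that by simp
    qed
    \<comment> \<open>The expansion constant adds two effects: changing the scale costs
      \<open>B\<close>, changing the sphere point costs \<open>L * (k + 2)\<close>. The domain has
      \<open>k + 2\<close> coordinates, the target \<open>k + 1\<close>.\<close>
    show False
    proof (rule no_expanding_map[of "B + L * (real k + 2)" "Suc k" Y "4 * (real k + 2)"])
      show "0 \<le> B + L * (real k + 2)" using B L by simp
      show "\<bar>Y z j\<bar> \<le> 4 * (real k + 2)" if "\<forall>i\<le>Suc k. 0 \<le> z i \<and> z i \<le> 1" for z j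
      proof -
        have z: "cube z" using that by (simp add: cube_def)
        have "\<bar>r z\<bar> * \<bar>x z j\<bar> \<le> \<bar>r z\<bar> * 1" by (intro mult_left_mono x1 z) auto
        also have "\<dots> \<le> 4 * (real k + 2)" using r[OF z] by simp
        finally show ?thesis by (simp add: Y_def abs_mult)
      qed
      fix z z' i
      assume "\<forall>i\<le>Suc k. 0 \<le> z i \<and> z i \<le> (1::real)" "\<forall>i\<le>Suc k. 0 \<le> z' i \<and> z' i \<le> (1::real)"
        and i: "i \<le> Suc k"
      then have z: "cube z" and z': "cube z'" by (simp_all add: cube_def)
      define D where "D = (\<Sum>j\<le>k. \<bar>Y z j - Y z' j\<bar>)"
      have rD: "\<bar>r z - r z'\<bar> \<le> D"
        using rdiff[OF z z'] rdiff[OF z' z] by (simp add: D_def abs_minus_commute abs_le_iff)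
      \<comment> \<open>Multiplying by \<open>r z'\<close> turns the difference of sphere points
        into a difference of \<open>Y\<close>-values, up to the error
        \<open>(r z' - r z) * x z j\<close>.\<close>
      have "r z' * \<bar>x z j - x z' j\<bar> \<le> D + \<bar>Y z j - Y z' j\<bar>" for j
      proof -
        have "r z' * \<bar>x z j - x z' j\<bar> = \<bar>r z' * (x z j - x z' j)\<bar>" using r(1)[OF z'] by (simp add: abs_mult)
        also have "\<dots> = \<bar>(r z' - r z) * x z j + (Y z j - Y z' j)\<bar>" by (simp add: Y_def algebra_simps)
        also have "\<dots> \<le> \<bar>r z' - r z\<bar> * \<bar>x z j\<bar> + \<bar>Y z j - Y z' j\<bar>"
          by (metis abs_mult abs_triangle_ineq)
        also have "\<bar>r z' - r z\<bar> * \<bar>x z j\<bar> \<le> D * 1"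
          using rD x1[OF z] by (intro mult_mono) (auto simp: abs_minus_commute)
        finally show ?thesis by simp
      qed
      then have "(\<Sum>j\<le>k. r z' * \<bar>x z j - x z' j\<bar>) \<le> (\<Sum>j\<le>k. D + \<bar>Y z j - Y z' j\<bar>)"
        by (intro sum_mono) auto
      then have xD: "r z' * (\<Sum>j\<le>k. \<bar>x z j - x z' j\<bar>) \<le> (real k + 2) * D"
        by (simp add: sum.distrib D_def sum_distrib_left algebra_simps)
      have "z i - z' i = (r z - r z') * q (x z) i + r z' * (q (x z) i - q (x z') i)"
        using zeq[OF z i] zeq[OF z' i] by (simp add: algebra_simps)
      then have "\<bar>z i - z' i\<bar> \<le> \<bar>r z - r z'\<bar> * \<bar>q (x z) i\<bar> + r z' * \<bar>q (x z) i - q (x z') i\<bar>"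
        using r(1)[OF z'] abs_triangle_ineq[of "(r z - r z') * q (x z) i" "r z' * (q (x z) i - q (x z') i)"]
        by (simp add: abs_mult)
      also have "\<dots> \<le> D * B + r z' * (L * (\<Sum>j\<le>k. \<bar>x z j - x z' j\<bar>))"
        using rD upper[OF x[OF z] i] lip[OF x[OF z] x[OF z'] i] r(1)[OF z']
        by (intro add_mono mult_mono mult_left_mono) auto
      also have "\<dots> = D * B + L * (r z' * (\<Sum>j\<le>k. \<bar>x z j - x z' j\<bar>))" by simp
      also have "\<dots> \<le> D * B + L * ((real k + 2) * D)"
        using xD L by (intro add_left_mono mult_left_mono)
      finally show "\<bar>z i - z' i\<bar> \<le> (B + L * (real k + 2)) * (\<Sum>j<Suc k. \<bar>Y z j - Y z' j\<bar>)"
        by (simp add: D_def algebra_simps lessThan_Suc_atMost)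
    qed
  qed
  then show thesis using that by blast
qed

section \<open>Compactness of spheres and Lipschitz approximation\<close>

lemma nsphere_eq_top_of_set: "nsphere n = top_of_set (topspace (nsphere n))"
  by (simp add: nsphere euclidean_product_topology)

text \<open>The ambient space is an infinite power of the reals, so compactness comes from
  Tychonoff's theorem for a cube containing the sphere.\<close>

lemma compact_nsphere: "compact (topspace (nsphere n))"
proof -
  let ?C = "\<Pi>\<^sub>E i\<in>(UNIV::nat set). {-1..1::real}"
  have "compact ?C"
    by (metis compactin_PiE compactin_euclidean_iff compact_Icc euclidean_product_topology)
  moreover have "closed (topspace (nsphere n))"
  proof -
    have "topspace (nsphere n) = {x. (\<Sum>i\<le>n. (x i)\<^sup>2) = 1} \<inter> (\<Inter>i\<in>{n<..}. {x. x i = 0})"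
      by (auto simp: topspace_nsphere)
    moreover have "closed {x::nat \<Rightarrow> real. (\<Sum>i\<le>n. (x i)\<^sup>2) = 1}"
      by (intro closed_Collect_eq continuous_intros continuous_on_product_coordinates)
    moreover have "closed {x::nat \<Rightarrow> real. x i = 0}" for i
      by (intro closed_Collect_eq continuous_intros continuous_on_product_coordinates)
    ultimately show ?thesis by (simp add: closed_Int closed_INT)
  qed
  moreover have "topspace (nsphere n) \<subseteq> ?C"
  proof
    fix x assume "x \<in> topspace (nsphere n)"
    then show "x \<in> ?C" using abs_nsphere_le_1[of x n] by (auto simp: abs_le_iff minus_le_iff)
  qed
  ultimately show ?thesis by (metis compact_Int_closed inf.absorb_iff2)
qed

text \<open>Stone-Weierstrass applies to the Lipschitz functions: products stay Lipschitz because
  the factors are bounded on the compact sphere, and the coordinates separate points.\<close>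

lemma lipschitz_approximation_nsphere:
  fixes n :: nat
  defines "S \<equiv> topspace (nsphere n)"
  assumes f: "continuous_map (nsphere n) euclideanreal f" and "e > 0"
  obtains g L where "continuous_map (nsphere n) euclideanreal g" "0 \<le> L" "\<And>x. x \<in> S \<Longrightarrow> \<bar>f x - g x\<bar> < e"
    "\<And>x y. \<lbrakk>x \<in> S; y \<in> S\<rbrakk> \<Longrightarrow> \<bar>g x - g y\<bar> \<le> L * (\<Sum>j\<le>n. \<bar>x j - y j\<bar>)"
proof -
  define dd where "dd x y = (\<Sum>j\<le>n. \<bar>x j - y j\<bar>)" for x y :: "nat \<Rightarrow> real"
  have dd0: "0 \<le> dd x y" for x y by (simp add: dd_def sum_nonneg)
  define lip where "lip L g \<longleftrightarrow> 0 \<le> L \<and> continuous_on S g \<and> (\<forall>x\<in>S. \<forall>y\<in>S. \<bar>g x - g y\<bar> \<le> L * dd x y)"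
    for L and g :: "(nat \<Rightarrow> real) \<Rightarrow> real"
  have comp: "compact S" by (simp add: S_def compact_nsphere)
  have bdd: "\<exists>b\<ge>0. \<forall>x\<in>S. \<bar>g x\<bar> \<le> b" if "lip L g" for L g
  proof -
    have "bounded (g ` S)"
      using that comp compact_continuous_image compact_imp_bounded unfolding lip_def by blast
    then show ?thesis unfolding bounded_real by (metis abs_ge_zero image_eqI linorder_le_cases order_trans)
  qed
  interpret function_ring_on "{g. \<exists>L. lip L g}" S
  proof
    show "compact S" by fact
    show "continuous_on S f" if "f \<in> {g. \<exists>L. lip L g}" for f
      using that by (auto simp: lip_def)
    show "(\<lambda>x. f x + g x) \<in> {g. \<exists>L. lip L g}" if fg: "f \<in> {g. \<exists>L. lip L g}" "g \<in> {g. \<exists>L. lip L g}" for f g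
    proof -
      obtain L M where "lip L f" "lip M g" using fg by auto
      have "lip (L + M) (\<lambda>x. f x + g x)"
        unfolding lip_def
      proof (intro conjI ballI)
        show "0 \<le> L + M" "continuous_on S (\<lambda>x. f x + g x)"
          using \<open>lip L f\<close> \<open>lip M g\<close> by (auto simp: lip_def intro: continuous_intros)
        fix x y assume "x \<in> S" "y \<in> S"
        then have "\<bar>f x - f y\<bar> \<le> L * dd x y" "\<bar>g x - g y\<bar> \<le> M * dd x y"
          using \<open>lip L f\<close> \<open>lip M g\<close> by (auto simp: lip_def)
        then show "\<bar>(f x + g x) - (f y + g y)\<bar> \<le> (L + M) * dd x y"
          by (simp add: distrib_right abs_le_iff)
      qed
      then show ?thesis by auto
    qed
    show "(\<lambda>x. f x * g x) \<in> {g. \<exists>L. lip L g}" if fg: "f \<in> {g. \<exists>L. lip L g}" "g \<in> {g. \<exists>L. lip L g}" for f g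
    proof -
      obtain L M where "lip L f" "lip M g" using fg by auto
      obtain a where a: "a \<ge> 0" "\<forall>x\<in>S. \<bar>f x\<bar> \<le> a"
        using bdd[OF \<open>lip L f\<close>] by blast
      obtain b where b: "b \<ge> 0" "\<forall>x\<in>S. \<bar>g x\<bar> \<le> b"
        using bdd[OF \<open>lip M g\<close>] by blast
      have "lip (L * b + a * M) (\<lambda>x. f x * g x)"
        unfolding lip_def
      proof (intro conjI ballI)
        show "0 \<le> L * b + a * M" "continuous_on S (\<lambda>x. f x * g x)"
          using \<open>lip L f\<close> \<open>lip M g\<close> a b by (auto simp: lip_def intro!: continuous_on_mult)
        fix x y assume x: "x \<in> S" and y: "y \<in> S"
        have "\<bar>f x * g x - f y * g y\<bar> = \<bar>(f x - f y) * g x + f y * (g x - g y)\<bar>"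
          by (simp add: algebra_simps)
        also have "\<dots> \<le> \<bar>f x - f y\<bar> * \<bar>g x\<bar> + \<bar>f y\<bar> * \<bar>g x - g y\<bar>"
          by (metis abs_mult abs_triangle_ineq)
        also have "\<dots> \<le> (L * dd x y) * b + a * (M * dd x y)"
          using \<open>lip L f\<close> \<open>lip M g\<close> x y a b dd0 by (intro add_mono mult_mono) (auto simp: lip_def)
        finally show "\<bar>f x * g x - f y * g y\<bar> \<le> (L * b + a * M) * dd x y"
          by (simp add: algebra_simps)
      qed
      then show ?thesis by auto
    qed
    show "(\<lambda>_. c) \<in> {g. \<exists>L. lip L g}" for c
      by (auto simp: lip_def intro!: exI[of _ 0])
    show "\<exists>f\<in>{g. \<exists>L. lip L g}. f x \<noteq> f y" if xy: "x \<in> S" "y \<in> S" "x \<noteq> y" for x y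
    proof -
      obtain i where i: "x i \<noteq> y i" using \<open>x \<noteq> y\<close> by blast
      have "i \<le> n"
      proof (rule ccontr)
        assume "\<not> i \<le> n"
        then have "x i = 0" "y i = 0" using xy by (auto simp: S_def topspace_nsphere)
        then show False using i by simp
      qed
      have "\<bar>u i - v i\<bar> \<le> 1 * dd u v" for u v
        unfolding dd_def using \<open>i \<le> n\<close> member_le_sum[of i "{..n}" "\<lambda>j. \<bar>u j - v j\<bar>"] by simp
      then have "lip 1 (\<lambda>x. x i)"
        unfolding lip_def by (auto intro: continuous_on_product_coordinates continuous_on_subset)
      then show ?thesis using i by (auto intro!: bexI[of _ "\<lambda>x. x i"])
    qed
  qed
  have "continuous_on S f"
    using f nsphere_eq_top_of_set[of n] by (metis S_def continuous_map_iff_continuous)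
  then obtain g L where "lip L g" "\<And>x. x \<in> S \<Longrightarrow> \<bar>f x - g x\<bar> < e"
    using Stone_Weierstrass_basic[OF _ \<open>e > 0\<close>] by blast
  moreover have "continuous_map (nsphere n) euclideanreal g"
    using \<open>lip L g\<close> nsphere_eq_top_of_set[of n] by (metis S_def continuous_map_iff_continuous lip_def)
  ultimately show thesis
    using that[of g L] by (auto simp: lip_def dd_def)
qed

section \<open>The degree of odd maps and the Borsuk-Ulam theorem\<close>

definition radial_projection :: "nat \<Rightarrow> (nat \<Rightarrow> real) \<Rightarrow> nat \<Rightarrow> real"
  where "radial_projection n y = (\<lambda>i. y i / sqrt (\<Sum>j\<le>n. (y j)\<^sup>2))"

text \<open>The norm involves only the coordinates up to \<open>n\<close>: \<open>zero\<close>
  ensures that no others remain, and \<open>nonzero\<close> rules out division by 0.\<close>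

lemma continuous_map_radial_projection:
  assumes cont: "\<And>i. continuous_map X euclideanreal (\<lambda>x. F x i)"
    and zero: "\<And>x i. \<lbrakk>x \<in> topspace X; i > n\<rbrakk> \<Longrightarrow> F x i = 0"
    and nonzero: "\<And>x. x \<in> topspace X \<Longrightarrow> \<exists>i\<le>n. F x i \<noteq> 0"
  shows "continuous_map X (nsphere n) (\<lambda>x. radial_projection n (F x))"
proof -
  have pos: "0 < (\<Sum>j\<le>n. (F x j)\<^sup>2)" if x: "x \<in> topspace X" for x
  proof -
    obtain i where "i \<le> n" "F x i \<noteq> 0" using nonzero[OF x] by blast
    then show ?thesis by (intro sum_pos2[of _ i]) auto
  qed
  have "continuous_map X euclideanreal (\<lambda>x. radial_projection n (F x) i)" for i
    unfolding radial_projection_def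
  proof (intro continuous_map_real_divide cont)
    show "continuous_map X euclideanreal (\<lambda>x. sqrt (\<Sum>j\<le>n. (F x j)\<^sup>2))"
      by (intro continuous_map_sqrt continuous_map_sum continuous_map_real_pow cont) auto
    show "sqrt (\<Sum>j\<le>n. (F x j)\<^sup>2) \<noteq> 0" if "x \<in> topspace X" for x
      using pos[OF that] by simp
  qed
  moreover have "radial_projection n (F x) \<in> topspace (nsphere n)" if "x \<in> topspace X" for x
    using pos[OF that] zero[OF that]
    by (simp add: topspace_nsphere radial_projection_def power_divide flip: sum_divide_distrib)
  ultimately show ?thesis
    by (simp add: nsphere continuous_map_in_subtopology continuous_map_componentwise_UNIV image_subset_iff)
qed

text \<open>The straight-line homotopy from \<open>f\<close> to \<open>g\<close> avoids the origin
  by \<open>nonzero\<close>, so it can be normalised back to the sphere.\<close>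

lemma homotopic_with_radial_projection:
  assumes f: "\<And>i. continuous_map (nsphere n) euclideanreal (\<lambda>x. f x i)"
    and g: "\<And>i. continuous_map (nsphere n) euclideanreal (\<lambda>x. g x i)"
    and zero: "\<And>x i. \<lbrakk>x \<in> topspace (nsphere n); i > n\<rbrakk> \<Longrightarrow> f x i = 0 \<and> g x i = 0"
    and nonzero: "\<And>x s. \<lbrakk>x \<in> topspace (nsphere n); 0 \<le> s; s \<le> 1\<rbrakk> \<Longrightarrow> \<exists>i\<le>n. (1 - s) * f x i + s * g x i \<noteq> 0"
  shows "homotopic_with (\<lambda>_. True) (nsphere n) (nsphere n) (\<lambda>x. radial_projection n (f x)) (\<lambda>x. radial_projection n (g x))"
  unfolding homotopic_with_def
proof (intro exI conjI allI ballI TrueI)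
  let ?H = "\<lambda>z i. (1 - fst z) * f (snd z) i + fst z * g (snd z) i"
  let ?X = "prod_topology (top_of_set {0..1::real}) (nsphere n)"
  show "continuous_map ?X (nsphere n) (\<lambda>z. radial_projection n (?H z))"
  proof (rule continuous_map_radial_projection)
    have 1: "continuous_map ?X euclideanreal fst"
      using continuous_map_fst continuous_map_into_fulltopology by blast
    have 2: "continuous_map ?X euclideanreal (\<lambda>z. f (snd z) i)" "continuous_map ?X euclideanreal (\<lambda>z. g (snd z) i)" for i
      using continuous_map_compose[OF continuous_map_snd f] continuous_map_compose[OF continuous_map_snd g]
      by (auto simp: o_def)
    show "continuous_map ?X euclideanreal (\<lambda>z. ?H z i)" for i
      by (intro continuous_map_add continuous_map_real_mult continuous_map_diff 1 2) auto
  qed (use zero nonzero in auto)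
qed (auto)

lemma radial_projection_nsphere: "x \<in> topspace (nsphere n) \<Longrightarrow> radial_projection n x = x"
  by (simp add: radial_projection_def topspace_nsphere)

lemma continuous_map_nsphere_uminus: "continuous_map (nsphere n) (nsphere n) (\<lambda>x i. - x i)"
proof -
  have "continuous_map (nsphere n) (nsphere n) (\<lambda>x. radial_projection n (\<lambda>i. - x i))"
  proof (rule continuous_map_radial_projection)
    show "continuous_map (nsphere n) euclideanreal (\<lambda>x. - x i)" for i
      by (intro continuous_map_minus continuous_map_nsphere_projection)
    show "\<exists>i\<le>n. - x i \<noteq> 0" if "x \<in> topspace (nsphere n)" for x
    proof (rule ccontr)
      assume "\<not> ?thesis"
      then show False using that by (simp add: topspace_nsphere)
    qed
  qed (auto simp: topspace_nsphere)
  then show ?thesis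
    by (rule continuous_map_eq) (simp add: radial_projection_nsphere uminus_nsphere)
qed

lemma continuous_map_nsphere_component:
  "continuous_map X (nsphere n) f \<Longrightarrow> continuous_map X euclideanreal (\<lambda>x. f x i)"
  using continuous_map_compose[OF _ continuous_map_nsphere_projection] by (auto simp: o_def)

text \<open>
  The library's \<open>Borsuk_odd_mapping_degree_step\<close> needs a map preserving the equator. We first deform
  \<open>f\<close> to an odd Lipschitz map \<open>q\<close>, which on the equator misses a direction \<open>p\<close> with last coordinate
  1, and then subtract \<open>q\<^sub>n\<close> times \<open>p - \<bar>x\<^sub>n\<bar> e\<^sub>n\<close>: on the equator this is the projection along \<open>p\<close>.
\<close>

theorem odd_Brouwer_degree2:
  assumes "continuous_map (nsphere n) (nsphere n) f"
    and "\<And>x. x \<in> topspace (nsphere n) \<Longrightarrow> f (\<lambda>i. - x i) = (\<lambda>i. - f x i)"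
  shows "odd (Brouwer_degree2 n f)"
  using assms
proof (induction n arbitrary: f)
  case (0 f)
  have S0: "y = x \<or> y = (\<lambda>i. - x i)" if "x \<in> topspace (nsphere 0)" "y \<in> topspace (nsphere 0)" for x y :: "nat \<Rightarrow> real"
  proof -
    have "(y 0)\<^sup>2 = (x 0)\<^sup>2" using that by (simp add: topspace_nsphere)
    then have "y 0 = x 0 \<or> y 0 = - x 0" by (simp only: power2_eq_iff)
    moreover have "y i = 0 \<and> x i = 0" if "i > 0" for i
      using that \<open>x \<in> _\<close> \<open>y \<in> _\<close> by (simp add: topspace_nsphere)
    ultimately show ?thesis by (metis (no_types) ext minus_zero not_gr_zero)
  qed
  \<comment> \<open>The sphere of dimension 0 consists of two antipodal points, so an odd self-map
    composed with itself is the identity and its degree squares to 1.\<close>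
  have "f (f x) = x" if x: "x \<in> topspace (nsphere 0)" for x
  proof -
    have "f x \<in> topspace (nsphere 0)" using 0(1) x by (auto simp: continuous_map_def)
    then consider "f x = x" | "f x = (\<lambda>i. - x i)" using S0[OF x] by blast
    then show ?thesis by cases (simp_all add: 0(2)[OF x])
  qed
  then have "Brouwer_degree2 0 (f \<circ> f) = Brouwer_degree2 0 id"
    by (intro Brouwer_degree2_eq) simp
  then have "Brouwer_degree2 0 f * Brouwer_degree2 0 f = 1"
    using Brouwer_degree2_compose[OF 0(1) 0(1)] by simp
  then show ?case by (metis even_mult_iff odd_one)
next
  case (Suc k f)
  define n where "n = Suc k"
  define S where "S = topspace (nsphere n)"
  \<comment> \<open>Errors of size \<open>e\<close> in each of the \<open>n + 1\<close> coordinates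
    sum to at most 1/2.\<close>
  define e :: real where "e = 1 / (2 * (real n + 1))"
  have contf: "continuous_map (nsphere n) (nsphere n) f" and odd_f: "\<And>x. x \<in> S \<Longrightarrow> f (\<lambda>i. - x i) = (\<lambda>i. - f x i)"
    using Suc.prems by (auto simp: n_def S_def)
  have fS: "f x \<in> topspace (nsphere n)" if "x \<in> S" for x
    using contf that by (auto simp: S_def continuous_map_def)
  have f1: "\<bar>f x i\<bar> \<le> 1" "(\<Sum>i\<le>n. f x i * f x i) = 1" if "x \<in> S" for x i
    using fS[OF that] abs_nsphere_le_1 by (auto simp: topspace_nsphere power2_eq_square)
  have neg: "(\<lambda>i. - x i) \<in> S" if "x \<in> S" for x using that by (simp add: S_def uminus_nsphere)
  have "e > 0" by (simp add: e_def)
  define approx where "approx i g L \<longleftrightarrow> continuous_map (nsphere n) euclideanreal g \<and> 0 \<le> L \<and> (\<forall>x\<in>S. \<bar>f x i - g x\<bar> < e) \<and>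
      (\<forall>x\<in>S. \<forall>y\<in>S. \<bar>g x - g y\<bar> \<le> L * (\<Sum>j\<le>n. \<bar>x j - y j\<bar>))" for i g L
  have "\<exists>g L. approx i g L" for i
  proof -
    obtain g L where "continuous_map (nsphere n) euclideanreal g" "0 \<le> L" "\<And>x. x \<in> S \<Longrightarrow> \<bar>f x i - g x\<bar> < e"
        "\<And>x y. \<lbrakk>x \<in> S; y \<in> S\<rbrakk> \<Longrightarrow> \<bar>g x - g y\<bar> \<le> L * (\<Sum>j\<le>n. \<bar>x j - y j\<bar>)"
      unfolding S_def
      using lipschitz_approximation_nsphere[OF continuous_map_nsphere_component[OF contf, of i] \<open>e > 0\<close>] by blast
    then show ?thesis unfolding approx_def by blast
  qed
  then obtain g L where gL: "\<And>i. approx i (g i) (L i)" by metis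
  have g: "continuous_map (nsphere n) euclideanreal (g i)" and L: "0 \<le> L i" for i
    using gL[of i] by (simp_all add: approx_def)
  have close: "\<bar>f x i - g i x\<bar> < e" if "x \<in> S" for i x
    using gL[of i] that by (simp add: approx_def)
  have lip: "\<bar>g i x - g i y\<bar> \<le> L i * (\<Sum>j\<le>n. \<bar>x j - y j\<bar>)" if "x \<in> S" "y \<in> S" for i x y
    using gL[of i] that by (simp add: approx_def)
  \<comment> \<open>This is the odd part of the approximation; since \<open>f\<close> is odd, it is
    still within \<open>e\<close> of \<open>f\<close>.\<close>
  define q where "q x i = (if i \<le> n then (g i x - g i (\<lambda>j. - x j)) / 2 else 0)" for x i
  have contq: "continuous_map (nsphere n) euclideanreal (\<lambda>x. q x i)" for i
  proof (cases "i \<le> n")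
    case True
    have "continuous_map (nsphere n) euclideanreal (\<lambda>x. (g i x - g i (\<lambda>j. - x j)) / 2)"
      using continuous_map_compose[OF continuous_map_nsphere_uminus g]
      by (intro continuous_map_real_divide continuous_map_diff g) (auto simp: o_def)
    then show ?thesis using True by (simp add: q_def)
  qed (simp add: q_def)
  have odd_q: "q (\<lambda>j. - x j) i = - q x i" for x i by (simp add: q_def diff_divide_distrib)
  have closeq: "\<bar>q x i - f x i\<bar> \<le> e" if "x \<in> S" "i \<le> n" for x i
  proof -
    have "\<bar>- f x i - g i (\<lambda>j. - x j)\<bar> < e"
      using close[OF neg[OF that(1)], of i] odd_f[OF that(1)] by simp
    with close[OF that(1), of i] show ?thesis using that(2) by (simp add: q_def abs_less_iff abs_le_iff field_simps)
  qed
  \<comment> \<open>The segment from \<open>f x\<close> to \<open>q x\<close> stays where the inner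
    product with \<open>f x\<close> is at least 1/2, so it avoids the origin; the endpoint
    \<open>s = 1\<close> bounds \<open>q\<close> from below.\<close>
  have inner: "1/2 \<le> (\<Sum>i\<le>n. ((1 - s) * f x i + s * q x i) * f x i)" if x: "x \<in> S" and s: "0 \<le> s" "s \<le> 1" for x s
  proof -
    have "- e \<le> s * ((q x i - f x i) * f x i)" if "i \<le> n" for i
    proof -
      have "\<bar>s * ((q x i - f x i) * f x i)\<bar> = s * (\<bar>q x i - f x i\<bar> * \<bar>f x i\<bar>)" using s by (simp add: abs_mult)
      also have "\<dots> \<le> 1 * (e * 1)"
        using closeq[OF x that] f1(1)[OF x] s \<open>e > 0\<close> by (intro mult_mono) auto
      finally show ?thesis by simp
    qed
    then have "(\<Sum>i\<le>n. - e) \<le> (\<Sum>i\<le>n. s * ((q x i - f x i) * f x i))" by (intro sum_mono) auto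
    moreover have "(\<Sum>i\<le>n. - e) = - (1/2)" by (simp add: e_def add_divide_distrib[symmetric] divide_simps)
    ultimately have "- (1/2) \<le> (\<Sum>i\<le>n. s * ((q x i - f x i) * f x i))" by simp
    moreover have "(\<Sum>i\<le>n. ((1 - s) * f x i + s * q x i) * f x i)
        = (\<Sum>i\<le>n. f x i * f x i) + (\<Sum>i\<le>n. s * ((q x i - f x i) * f x i))"
      unfolding sum.distrib[symmetric] by (intro sum.cong) (auto simp: algebra_simps)
    ultimately show ?thesis using f1(2)[OF x] by linarith
  qed
  have q_lower: "1/2 \<le> (\<Sum>i\<le>n. \<bar>q x i\<bar>)" if x: "x \<in> S" for x
  proof -
    have "1/2 \<le> (\<Sum>i\<le>n. q x i * f x i)" using inner[OF x, of 1] by simp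
    also have "\<dots> \<le> (\<Sum>i\<le>n. \<bar>q x i\<bar>)"
    proof (intro sum_mono)
      fix i
      have "\<bar>q x i\<bar> * \<bar>f x i\<bar> \<le> \<bar>q x i\<bar> * 1" using f1(1)[OF x] by (intro mult_left_mono) auto
      then show "q x i * f x i \<le> \<bar>q x i\<bar>" by (metis abs_le_D1 abs_mult mult.right_neutral)
    qed
    finally show ?thesis .
  qed
  have q_nonzero: "\<exists>i\<le>n. q x i \<noteq> 0" if "x \<in> S" for x
  proof (rule ccontr)
    assume "\<not> ?thesis"
    then have "(\<Sum>i\<le>n. \<bar>q x i\<bar>) = 0" by simp
    then show False using q_lower[OF that] by linarith
  qed
  have equator: "x \<in> S" "x n = 0" if "x \<in> topspace (nsphere k)" for x
    using that by (auto simp: S_def n_def topspace_nsphere)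
  obtain p where p: "p n = 1" "\<And>x. x \<in> topspace (nsphere k) \<Longrightarrow> \<exists>i\<le>n. q x i \<noteq> q x n * p i"
  proof (rule lipschitz_misses_direction[where q = q and k = k and L = "\<Sum>i\<le>n. L i" and B = "1 + e"])
    show "0 \<le> (\<Sum>i\<le>n. L i)" by (intro sum_nonneg L)
    show "\<bar>q x i - q y i\<bar> \<le> (\<Sum>i\<le>n. L i) * (\<Sum>j\<le>k. \<bar>x j - y j\<bar>)"
      if x: "x \<in> topspace (nsphere k)" and y: "y \<in> topspace (nsphere k)" and i: "i \<le> Suc k" for x y i
    proof -
      let ?d = "\<Sum>j\<le>k. \<bar>x j - y j\<bar>"
      have d: "(\<Sum>j\<le>n. \<bar>x j - y j\<bar>) = ?d" "(\<Sum>j\<le>n. \<bar>- x j - - y j\<bar>) = ?d"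
        using equator[OF x] equator[OF y] by (simp_all add: n_def abs_minus_commute)
      have "\<bar>g i x - g i y\<bar> \<le> L i * ?d" "\<bar>g i (\<lambda>j. - x j) - g i (\<lambda>j. - y j)\<bar> \<le> L i * ?d"
        using lip[OF equator(1)[OF x] equator(1)[OF y], of i]
          lip[OF neg[OF equator(1)[OF x]] neg[OF equator(1)[OF y]], of i] d by simp_all
      then have "\<bar>q x i - q y i\<bar> \<le> L i * ?d"
        using i by (simp add: q_def n_def abs_le_iff field_simps)
      also have "\<dots> \<le> (\<Sum>i\<le>n. L i) * ?d"
        using i L by (intro mult_right_mono member_le_sum sum_nonneg) (auto simp: n_def)
      finally show ?thesis .
    qed
    show "\<bar>q x i\<bar> \<le> 1 + e" if "x \<in> topspace (nsphere k)" "i \<le> Suc k" for x i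
      using closeq[OF equator(1)[OF that(1)], of i] f1(1)[OF equator(1)[OF that(1)], of i] that(2)
      by (simp add: n_def)
    show "1/2 \<le> (\<Sum>i\<le>Suc k. \<bar>q x i\<bar>)" if "x \<in> topspace (nsphere k)" for x
      using q_lower[OF equator(1)[OF that]] by (simp add: n_def)
  qed (auto simp: odd_q n_def that)
  \<comment> \<open>As \<open>p n = 1\<close>, the last coordinate of \<open>r x\<close> is
    \<open>q x n * \<bar>x n\<bar>\<close>: it vanishes on the equator, and the evenness of
    \<open>\<bar>x n\<bar>\<close> keeps \<open>r\<close> odd.\<close>
  define r where "r x i = (if i \<le> n then q x i - q x n * (p i - (if i = n then \<bar>x n\<bar> else 0)) else 0)" for x i
  have contr: "continuous_map (nsphere n) euclideanreal (\<lambda>x. r x i)" for i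
    unfolding r_def
    by (cases "i \<le> n"; cases "i = n")
      (auto intro!: continuous_map_diff continuous_map_real_mult continuous_map_real_abs contq continuous_map_nsphere_projection)
  \<comment> \<open>A zero on the segment from \<open>q x\<close> to \<open>r x\<close> forces
    \<open>s = 1\<close> and \<open>x n = 0\<close>; then \<open>q x\<close> is a multiple of
    \<open>p\<close> at a point of the equator, which the choice of \<open>p\<close>
    excludes.\<close>
  have qr: "\<exists>i\<le>n. (1 - s) * q x i + s * r x i \<noteq> 0" if x: "x \<in> S" and s: "0 \<le> s" "s \<le> 1" for x s
  proof (rule ccontr)
    assume "\<not> ?thesis"
    then have *: "(1 - s) * q x i + s * r x i = 0" if "i \<le> n" for i using that by blast
    have eq: "q x i = s * (q x n * p i)" if "i < n" for i
      using *[of i] that by (simp add: r_def algebra_simps)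
    have eqn: "q x n * (1 - s * (1 - \<bar>x n\<bar>)) = 0"
      using *[of n] by (simp add: r_def p algebra_simps)
    have "q x n \<noteq> 0"
    proof
      assume "q x n = 0"
      then have "q x i = 0" if "i \<le> n" for i using eq[of i] that by (cases "i = n") auto
      then show False using q_nonzero[OF x] by blast
    qed
    then have "s * (1 - \<bar>x n\<bar>) = 1" using eqn by simp
    moreover have "s * (1 - \<bar>x n\<bar>) \<le> 1 - s * \<bar>x n\<bar>" using s by (simp add: algebra_simps)
    moreover have "s * \<bar>x n\<bar> \<ge> 0" using s by simp
    ultimately have "s * \<bar>x n\<bar> = 0" by linarith
    with \<open>s * (1 - \<bar>x n\<bar>) = 1\<close> have "s = 1" "x n = 0" by (auto simp: algebra_simps)
    then have "x \<in> topspace (nsphere k)"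
      using topspace_nsphere_minus1[of x n] x by (simp add: S_def n_def)
    moreover have "q x i = q x n * p i" if "i \<le> n" for i
      using eq[of i] that \<open>s = 1\<close> p(1) by (cases "i = n") auto
    ultimately show False using p(2) by blast
  qed
  define h where "h x = radial_projection n (r x)" for x
  have "homotopic_with (\<lambda>_. True) (nsphere n) (nsphere n) (\<lambda>x. radial_projection n (f x)) (\<lambda>x. radial_projection n (q x))"
  proof (rule homotopic_with_radial_projection)
    show "continuous_map (nsphere n) euclideanreal (\<lambda>x. f x i)" for i
      by (rule continuous_map_nsphere_component[OF contf])
    show "f x i = 0 \<and> q x i = 0" if "x \<in> topspace (nsphere n)" "n < i" for x i
      using fS[of x] that by (simp add: S_def topspace_nsphere q_def)
    show "\<exists>i\<le>n. (1 - s) * f x i + s * q x i \<noteq> 0" if x: "x \<in> topspace (nsphere n)" and s: "0 \<le> s" "s \<le> 1" for x s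
    proof (rule ccontr)
      assume "\<not> ?thesis"
      then have "(\<Sum>i\<le>n. ((1 - s) * f x i + s * q x i) * f x i) = 0" by (intro sum.neutral) auto
      then show False using inner[of x s] x s by (simp add: S_def)
    qed
  qed (rule contq)
  moreover have "homotopic_with (\<lambda>_. True) (nsphere n) (nsphere n) (\<lambda>x. radial_projection n (q x)) h"
    unfolding h_def
  proof (rule homotopic_with_radial_projection)
    show "q x i = 0 \<and> r x i = 0" if "n < i" for x i using that by (simp add: q_def r_def)
  qed (use contq contr qr S_def in blast)+
  ultimately have hom: "homotopic_with (\<lambda>_. True) (nsphere n) (nsphere n) (\<lambda>x. radial_projection n (f x)) h"
    by (rule homotopic_with_trans)
  have "Brouwer_degree2 n f = Brouwer_degree2 n (\<lambda>x. radial_projection n (f x))"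
    using fS by (intro Brouwer_degree2_eq) (simp add: radial_projection_nsphere S_def)
  also have "\<dots> = Brouwer_degree2 n h" using hom by (rule Brouwer_degree2_homotopic)
  finally have deg: "Brouwer_degree2 n f = Brouwer_degree2 n h" .
  have conth: "continuous_map (nsphere n) (nsphere n) h"
    using homotopic_with_imp_continuous_maps[OF hom] by blast
  have "r (\<lambda>j. - x j) = (\<lambda>i. - r x i)" for x by (auto simp: r_def odd_q algebra_simps)
  then have odd_h: "h (\<lambda>j. - x j) = (\<lambda>i. - h x i)" for x by (simp add: h_def radial_projection_def)
  have h_equator: "h x \<in> topspace (nsphere k)" if x: "x \<in> topspace (nsphere k)" for x
  proof -
    have "h x \<in> topspace (nsphere n)"
      using conth equator(1)[OF x] by (auto simp: S_def continuous_map_def)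
    moreover have "h x n = 0" using equator(2)[OF x] by (simp add: h_def radial_projection_def r_def p)
    ultimately show ?thesis using topspace_nsphere_minus1[of "h x" n] by (simp add: n_def)
  qed
  have "continuous_map (nsphere k) (nsphere n) h"
    using continuous_map_from_subtopology[OF conth, of "{x. x n = 0}"]
    by (simp add: n_def subtopology_nsphere_equator)
  moreover have "h ` topspace (nsphere k) \<subseteq> {x. x n = 0}"
    using h_equator equator(2) by blast
  ultimately have "continuous_map (nsphere k) (nsphere k) h"
    by (metis continuous_map_in_subtopology image_subset_iff_funcset n_def subtopology_nsphere_equator)
  \<comment> \<open>The restriction of \<open>h\<close> to the equator has odd degree by induction,
    and the degree of \<open>h\<close> on the whole sphere has the same parity.\<close>
  then have "odd (Brouwer_degree2 k h)" using Suc.IH odd_h by blast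
  moreover have "even (Brouwer_degree2 n h - Brouwer_degree2 (n - Suc 0) h)"
    by (rule Borsuk_odd_mapping_degree_step[OF conth]) (use odd_h h_equator in \<open>auto simp: n_def\<close>)
  ultimately show ?case using deg by (simp add: n_def)
qed

text \<open>Without a common zero, \<open>F\<close> padded by a zero coordinate and normalised is an
  odd self-map of the sphere landing in the equator. It misses the pole, so its degree is 0, which
  is not odd.\<close>

theorem Borsuk_Ulam:
  fixes F :: "(nat \<Rightarrow> real) \<Rightarrow> nat \<Rightarrow> real"
  assumes cont: "\<And>i. i < d \<Longrightarrow> continuous_map (nsphere d) euclideanreal (\<lambda>x. F x i)"
    and odd: "\<And>x i. \<lbrakk>x \<in> topspace (nsphere d); i < d\<rbrakk> \<Longrightarrow> F (\<lambda>j. - x j) i = - F x i"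
  obtains x where "x \<in> topspace (nsphere d)" "\<And>i. i < d \<Longrightarrow> F x i = 0"
proof (rule ccontr)
  assume "\<not> thesis"
  then have nz: "\<exists>i<d. F x i \<noteq> 0" if "x \<in> topspace (nsphere d)" for x
    using that \<open>\<And>x. \<lbrakk>x \<in> topspace (nsphere d); \<And>i. i < d \<Longrightarrow> F x i = 0\<rbrakk> \<Longrightarrow> thesis\<close> by blast
  define E where "E x i = (if i < d then F x i else 0)" for x i
  define h where "h x = radial_projection d (E x)" for x
  have "continuous_map (nsphere d) (nsphere d) h"
    unfolding h_def
  proof (rule continuous_map_radial_projection)
    show "continuous_map (nsphere d) euclideanreal (\<lambda>x. E x i)" for i
      using cont by (cases "i < d") (auto simp: E_def)
    show "\<exists>i\<le>d. E x i \<noteq> 0" if "x \<in> topspace (nsphere d)" for x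
    proof -
      obtain i where "i < d" "F x i \<noteq> 0" using nz[OF \<open>x \<in> _\<close>] by blast
      then show ?thesis by (intro exI[of _ i]) (auto simp: E_def)
    qed
  qed (simp add: E_def)
  moreover have "h (\<lambda>j. - x j) = (\<lambda>i. - h x i)" if "x \<in> topspace (nsphere d)" for x
  proof -
    have "E (\<lambda>j. - x j) = (\<lambda>i. - E x i)" using odd[OF that] by (auto simp: E_def)
    then show ?thesis by (simp add: h_def radial_projection_def)
  qed
  ultimately have "odd (Brouwer_degree2 d h)" by (rule odd_Brouwer_degree2)
  moreover have "Brouwer_degree2 d h = 0"
  proof (rule Brouwer_degree2_nonsurjective)
    let ?pole = "\<lambda>i. if i = d then 1 else 0 :: real"
    have "?pole \<in> topspace (nsphere d)"
      by (simp add: topspace_nsphere if_distrib[of "\<lambda>x. x\<^sup>2"] cong: if_cong)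
    moreover have "h x \<noteq> ?pole" for x
    proof
      assume "h x = ?pole"
      then have "h x d = 1" by simp
      then show False by (simp add: h_def radial_projection_def E_def)
    qed
    ultimately show "h ` topspace (nsphere d) \<noteq> topspace (nsphere d)" by (metis imageE)
  qed fact
  ultimately show False by simp
qed

section \<open>Colors and vanishing moments\<close>

lemma sum_poly_eq_0:
  fixes w :: "'a \<Rightarrow> real" and c :: "'a \<Rightarrow> real"
  assumes moments: "\<And>k. k < d \<Longrightarrow> (\<Sum>v\<in>V. w v * c v ^ k) = 0" and "Polynomial.degree p < d"
  shows "(\<Sum>v\<in>V. w v * poly p (c v)) = 0"
proof -
  have "(\<Sum>v\<in>V. w v * poly p (c v)) = (\<Sum>v\<in>V. \<Sum>k\<le>Polynomial.degree p. Polynomial.coeff p k * (w v * c v ^ k))"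
    by (simp add: poly_altdef sum_distrib_left mult_ac)
  also have "\<dots> = (\<Sum>k\<le>Polynomial.degree p. Polynomial.coeff p k * (\<Sum>v\<in>V. w v * c v ^ k))"
    by (subst sum.swap) (simp add: sum_distrib_left)
  also have "\<dots> = 0"
    by (intro sum.neutral) (use assms in auto)
  finally show ?thesis .
qed

text \<open>
  The polynomial \<open>(X - c m) \<Prod>s. (X - s)\<^sup>2\<close>, with \<open>s\<close> ranging over the remaining colors of \<open>S\<close>,
  vanishes on the colors of \<open>S\<close> and is positive on those of \<open>T\<close>. The simple root at the smallest
  color makes the degree odd, which gains the 1 on the left hand side of the bound.
\<close>

lemma vanishing_moments_card:
  fixes w :: "'a \<Rightarrow> real" and c :: "'a \<Rightarrow> nat"
  assumes "finite V" and "S \<subseteq> V" "T \<subseteq> V" and "d \<ge> 1"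
    and pos: "\<And>v. v \<in> S \<Longrightarrow> w v > 0" and neg: "\<And>v. v \<in> T \<Longrightarrow> w v < 0"
    and zero: "\<And>v. \<lbrakk>v \<in> V; v \<notin> S; v \<notin> T\<rbrakk> \<Longrightarrow> w v = 0"
    and moments: "\<And>k. k < d \<Longrightarrow> (\<Sum>v\<in>V. w v * real (c v) ^ k) = 0"
    and disjoint: "c ` S \<inter> c ` T = {}"
    and m: "m \<in> S" "\<And>v. v \<in> T \<Longrightarrow> c m \<le> c v"
  shows "T \<noteq> {}" "d + 1 \<le> 2 * card (c ` S)"
proof -
  have S: "finite S" and T: "finite T" using assms(1-3) finite_subset by blast+
  have ST: "S \<inter> T = {}" using disjoint by blast
  have split: "(\<Sum>v\<in>V. w v * u v) = (\<Sum>v\<in>S. w v * u v) + (\<Sum>v\<in>T. w v * u v)" for u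
  proof -
    have "(\<Sum>v\<in>V. w v * u v) = (\<Sum>v\<in>S \<union> T. w v * u v)"
      using assms(1-3) zero by (intro sum.mono_neutral_right) auto
    then show ?thesis using S T ST by (simp add: sum.union_disjoint)
  qed
  show "T \<noteq> {}"
  proof
    assume "T = {}"
    \<comment> \<open>The moment of order 0 is the total weight; it is among the vanishing ones
      because \<open>d \<ge> 1\<close>.\<close>
    then have "(\<Sum>v\<in>S. w v) = 0" using moments[of 0] split[of "\<lambda>_. 1"] \<open>d \<ge> 1\<close> by simp
    moreover have "(\<Sum>v\<in>S. w v) > 0" using S m pos by (intro sum_pos) auto
    ultimately show False by simp
  qed
  show "d + 1 \<le> 2 * card (c ` S)"
  proof (rule ccontr)
    assume few: "\<not> ?thesis"
    define C where "C = c ` S - {c m}"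
    define p where "p = [:- real (c m), 1:] * (\<Prod>s\<in>C. [:- real s, 1:]\<^sup>2)"
    have "card (c ` S) > 0" using S m by (simp add: card_gt_0_iff) blast
    have cardC: "card C = card (c ` S) - 1" using S m by (simp add: C_def)
    have "Polynomial.degree (\<Prod>s\<in>C. [:- real s, 1:]\<^sup>2) \<le> (\<Sum>s\<in>C. Polynomial.degree ([:- real s, 1:]\<^sup>2))"
      using S by (intro degree_prod_sum_le[THEN order_trans]) (auto simp: C_def)
    also have "\<dots> \<le> (\<Sum>s\<in>C. 2)" by (intro sum_mono) (auto intro: degree_power_le[THEN order_trans])
    finally have "Polynomial.degree p \<le> 1 + 2 * card C"
      unfolding p_def by (intro degree_mult_le[THEN order_trans]) simp
    \<comment> \<open>If the bound fails, twice the number of colors of \<open>S\<close> is at most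
      \<open>d\<close>, and the degree of \<open>p\<close> is at most that double minus 1.\<close>
    then have "Polynomial.degree p < d" using few cardC \<open>card (c ` S) > 0\<close> by linarith
    have p_eval: "poly p (real x) = (real x - real (c m)) * (\<Prod>s\<in>C. (real x - real s)\<^sup>2)" for x
      by (simp add: p_def poly_prod left_diff_distrib)
    have pS: "poly p (real (c v)) = 0" if "v \<in> S" for v
      using that S unfolding p_eval by (cases "c v = c m") (auto simp: C_def)
    have pT: "poly p (real (c v)) > 0" if "v \<in> T" for v
    proof -
      have "c v \<notin> c ` S" using disjoint that by blast
      then have "c v \<noteq> c m" "c v \<notin> C" using m(1) by (auto simp: C_def)
      then have "c m < c v" using m(2)[OF that] by simp
      then show ?thesis using \<open>c v \<notin> C\<close> unfolding p_eval
        by (intro mult_pos_pos prod_pos) auto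
    qed
    \<comment> \<open>The terms of \<open>S\<close> drop out, and each term of \<open>T\<close> is a
      negative weight times a positive value.\<close>
    have "0 = (\<Sum>v\<in>V. w v * poly p (real (c v)))"
      using sum_poly_eq_0[where d = d and V = V and w = w and c = "\<lambda>v. real (c v)" and p = p] moments \<open>Polynomial.degree p < d\<close> by simp
    also have "\<dots> = (\<Sum>v\<in>T. w v * poly p (real (c v)))" by (simp add: split pS)
    also have "\<dots> < (\<Sum>v\<in>T. 0)"
      using T \<open>T \<noteq> {}\<close> by (rule sum_strict_mono) (simp add: mult_neg_pos neg pT)
    finally show False by simp
  qed
qed

text \<open>A vertex on one side of a simplex sees all colors of the other side, so it suffices to
  find a simplex with a nonempty side facing one that carries at least \<open>(d + 1) / 2\<close>
  colors.\<close>

lemma colorful_neighbourhood: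
  fixes G :: "'a pair_pre_digraph" and c :: "'a \<Rightarrow> nat"
  assumes "pair_graph G" and c: "proper_coloring G c" and "d \<ge> 1"
    and contf: "continuous_map (nsphere d) (geometric_realization (box_complex G)) f"
    and equivariant: "\<And>x. x \<in> topspace (nsphere d) \<Longrightarrow> f (\<lambda>i. - x i) = box_involution (f x)"
  obtains v where "v \<in> pverts G" "d + 1 \<le> 2 * card (c ` neighbours G v)"
proof -
  interpret pair_graph G by fact
  define V where "V = pverts G"
  have "finite V" by (simp add: V_def)
  define F where "F x k = (\<Sum>v\<in>V. (f x (v, 1) - f x (v, 2)) * real (c v) ^ k)" for x k
  have contc: "continuous_map (nsphere d) euclideanreal (\<lambda>x. f x w)" for w
  proof -
    have "continuous_map (geometric_realization (box_complex G)) euclideanreal (\<lambda>y. y w)"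
      unfolding geometric_realization_def
      by (intro continuous_map_from_subtopology continuous_map_product_projection) simp
    then show ?thesis using continuous_map_compose[OF contf] by (auto simp: o_def)
  qed
  obtain x where x: "x \<in> topspace (nsphere d)" and Fx: "\<And>k. k < d \<Longrightarrow> F x k = 0"
  proof (rule Borsuk_Ulam[of d F])
    show "continuous_map (nsphere d) euclideanreal (\<lambda>x. F x k)" for k
      unfolding F_def using \<open>finite V\<close>
      by (intro continuous_map_sum continuous_map_real_mult continuous_map_diff contc) auto
    \<comment> \<open>The involution exchanges the two copies of each vertex, so every weight
      changes sign.\<close>
    show "F (\<lambda>j. - x j) k = - F x k" if "x \<in> topspace (nsphere d)" for x k
      by (simp add: F_def equivariant[OF that] box_involution_def box_swap_def algebra_simps flip: sum_negf)
  qed (use that in blast)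
  define y where "y = f x"
  have y: "\<And>w. 0 \<le> y w" "{w. y w \<noteq> 0} \<in> box_complex G" "(\<Sum>w | y w \<noteq> 0. y w) = 1"
    using contf x by (auto simp: continuous_map_def geometric_realization_def y_def Pi_iff)
  then obtain S T where ST: "{w. y w \<noteq> 0} = box_join S T" "S \<subseteq> V" "T \<subseteq> V" "S \<inter> T = {}"
    and arcs: "\<And>s t. \<lbrakk>s \<in> S; t \<in> T\<rbrakk> \<Longrightarrow> (s, t) \<in> parcs G"
    unfolding box_complex_def V_def by blast
  have y1: "y (v, 1) \<noteq> 0 \<longleftrightarrow> v \<in> S" and y2: "y (v, 2) \<noteq> 0 \<longleftrightarrow> v \<in> T" for v
    using ST(1) by (auto simp: box_join_def set_eq_iff)
  define w where "w v = y (v, 1) - y (v, 2)" for v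
  \<comment> \<open>As \<open>S\<close> and \<open>T\<close> are disjoint, at most one of the two
    terms of \<open>w v\<close> is nonzero, and the sign of \<open>w v\<close> tells the side of
    \<open>v\<close>.\<close>
  have wS: "w v > 0" if "v \<in> S" for v
    using y1[of v] y2[of v] y(1)[of "(v,1)"] that ST(4) unfolding w_def by force
  have wT: "w v < 0" if "v \<in> T" for v
    using y1[of v] y2[of v] y(1)[of "(v,2)"] that ST(4) unfolding w_def by force
  have w0: "w v = 0" if "v \<notin> S" "v \<notin> T" for v
    using y1[of v] y2[of v] that by (simp add: w_def)
  have moments: "(\<Sum>v\<in>V. w v * real (c v) ^ k) = 0" if "k < d" for k
    using Fx[OF that] by (simp add: F_def w_def y_def)
  have disj: "c ` S \<inter> c ` T = {}"
    using c arcs by (fastforce simp: proper_coloring_def)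
  \<comment> \<open>Barycentric coordinates sum to 1, which excludes the empty simplex; so a vertex
    \<open>m\<close> of smallest color exists.\<close>
  have "S \<union> T \<noteq> {}"
  proof
    assume "S \<union> T = {}"
    then show False using y(3) ST(1) by (simp add: box_join_def)
  qed
  moreover have "finite (S \<union> T)" using ST(2,3) \<open>finite V\<close> by (meson finite_subset le_sup_iff)
  ultimately obtain m where m: "m \<in> S \<union> T" "\<And>v. v \<in> S \<union> T \<Longrightarrow> c m \<le> c v"
    by (metis arg_min_if_finite(1) arg_min_least)
  have nb: "card (c ` A) \<le> card (c ` neighbours G v)" if "\<And>u. u \<in> A \<Longrightarrow> (v, u) \<in> parcs G" for A v
  proof (rule card_mono)
    have "neighbours G v \<subseteq> V" by (auto simp: neighbours_def V_def dest: in_arcsD2)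
    then show "finite (c ` neighbours G v)" using \<open>finite V\<close> finite_subset by blast
    show "c ` A \<subseteq> c ` neighbours G v" using that by (auto simp: neighbours_def)
  qed
  from m(1) show thesis
  proof
    assume "m \<in> S"
    have *: "T \<noteq> {}" "d + 1 \<le> 2 * card (c ` S)"
      using vanishing_moments_card[OF \<open>finite V\<close> ST(2,3) \<open>d \<ge> 1\<close> wS wT w0 moments disj \<open>m \<in> S\<close>] m(2)
      by auto
    then obtain v where "v \<in> T" by blast
    then have "(v, u) \<in> parcs G" if "u \<in> S" for u using arcs that arcs_symmetric by blast
    then show thesis using nb[of S v] *(2) that[of v] \<open>v \<in> T\<close> ST(3) by (force simp: V_def)
  next
    assume "m \<in> T"
    \<comment> \<open>In the mirror case, negating the weights exchanges the signs of the two sides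
      and keeps the moments zero.\<close>
    have *: "S \<noteq> {}" "d + 1 \<le> 2 * card (c ` T)"
      using vanishing_moments_card[where V = V and S = T and T = S and d = d and w = "\<lambda>v. - w v" and c = c and m = m] \<open>finite V\<close> ST \<open>d \<ge> 1\<close> wS wT w0 moments disj \<open>m \<in> T\<close> m(2)
      by (auto simp: sum_negf Int_commute)
    then obtain v where "v \<in> S" by blast
    then show thesis using nb[of T v] *(2) that[of v] \<open>v \<in> S\<close> ST(2) arcs by (force simp: V_def)
  qed
qed

section \<open>From the coindex to the local chromatic number\<close>

theorem theorem2p1:
  fixes G :: "'a pair_pre_digraph" and t :: int
  assumes "t \<ge> 2"
    and "pair_graph G"
    and "topologically_chromatic t G"
  shows "int (local_chromatic_number G) \<ge> \<lceil>real_of_int t / 2\<rceil> + 1"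
proof -
  interpret pair_graph G by fact
  let ?X = "geometric_realization (box_complex G)"
  define D where "D = {d :: nat. \<exists>f. continuous_map (nsphere d) ?X f \<and>
      (\<forall>x\<in>topspace (nsphere d). f (\<lambda>i. - x i) = box_involution (f x))}"
  have coind: "coind ?X box_involution = Sup ((\<lambda>d. ereal (real d)) ` D)"
    by (simp add: coind_def D_def image_Collect)
  \<comment> \<open>The dimensions in \<open>D\<close> are integers: if none reached
    \<open>t - 1\<close>, all would be at most \<open>t - 2\<close>, and so would their supremum.
    This also covers an empty \<open>D\<close> and an infinite supremum.\<close>
  obtain d where "d \<in> D" and d: "t - 1 \<le> int d"
  proof (rule ccontr)
    assume "\<not> thesis"
    then have "\<And>d. d \<in> D \<Longrightarrow> \<not> t - 1 \<le> int d" using that by blast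
    then have "int d \<le> t - 2" if "d \<in> D" for d using that by force
    then have "Sup ((\<lambda>d. ereal (real d)) ` D) \<le> ereal (real_of_int (t - 2))"
      by (intro SUP_least) fastforce
    moreover have "ereal (real_of_int (t - 1)) \<le> Sup ((\<lambda>d. ereal (real d)) ` D)"
      using assms(3) by (simp add: topologically_chromatic_def coind)
    ultimately have "ereal (real_of_int (t - 1)) \<le> ereal (real_of_int (t - 2))" by (rule order_trans[rotated])
    then show False by simp
  qed
  then obtain f where f: "continuous_map (nsphere d) ?X f"
      "\<And>x. x \<in> topspace (nsphere d) \<Longrightarrow> f (\<lambda>i. - x i) = box_involution (f x)"
    by (auto simp: D_def)
  have "d \<ge> 1" using d \<open>t \<ge> 2\<close> by simp
  have "nat \<lceil>real_of_int t / 2\<rceil> \<le> (MAX v \<in> pverts G. card (c ` neighbours G v))" if "proper_coloring G c" for c :: "'a \<Rightarrow> nat"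
  proof -
    obtain v where v: "v \<in> pverts G" "d + 1 \<le> 2 * card (c ` neighbours G v)"
      using colorful_neighbourhood[OF \<open>pair_graph G\<close> \<open>proper_coloring G c\<close> \<open>d \<ge> 1\<close> f] by blast
    have "nat \<lceil>real_of_int t / 2\<rceil> \<le> card (c ` neighbours G v)"
      using v(2) d by (simp add: ceiling_le_iff)
    also have "\<dots> \<le> (MAX v \<in> pverts G. card (c ` neighbours G v))"
      using v(1) by (intro Max_ge) auto
    finally show ?thesis .
  qed
  \<comment> \<open>The infimum of an empty set of naturals would be a default value, so the
    existence of a proper coloring enters here.\<close>
  then have "nat \<lceil>real_of_int t / 2\<rceil> \<le> (INF c \<in> {c :: 'a \<Rightarrow> nat. proper_coloring G c}.
       (MAX v \<in> pverts G. card (c ` neighbours G v)))"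
    using proper_coloring_exists[OF \<open>pair_graph G\<close>] by (intro cINF_greatest) auto
  then show ?thesis by (simp add: local_chromatic_number_def nat_le_iff)
qed

end
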